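(* Let $n\ge k\ge 0$ be integers and let $G$ be any graph in $\mathcal{C}_n^k$. Then $$\prod\nolimits_{2}(G)\;\le\;\begin{cases}(n-2)^{n-2}\,2^{2(n-k-1)} & \text{if } n-k\equiv 0 \pmod 2,\\[2pt] (n-1)^{n-1}\,2^{2(n-k-1)} & \text{if } n-k\equiv 1 \pmod 2.\end{cases}$$ If $n-k\equiv 0\pmod 2$, equality holds if and only if the degree sequence of $G$ is $n-2,\underbrace{2,2,\dots,2}_{n-k-1},\underbrace{1,1,\dots,1}_{k}$. If $n-k\equiv 1\pmod 2$, equality holds if and only if the degree sequence of $G$ is $n-1,\underbrace{2,2,\dots,2}_{n-k-1},\underbrace{1,1,\dots,1}_{k}$.
   Context: Graphs are simple and connected. A cactus is a connected graph all of whose blocks are either edges or cycles, i.e. any two of its cycles have at most one common vertex (trees are included). A pendant vertex is a vertex of degree $1$. For $n\ge k\ge 0$, $\mathcal{C}_n^k$ denotes the set of cactus graphs with $n$ vertices including $k$ pendant vertices. The second multiplicative Zagreb index is $\prod_2(G)=\prod_{uv\in E(G)}d(u)d(v)$, which can be rewritten as $\prod_{v\in V(G)}d(v)^{d(v)}$, where $d(v)$ is the degree of $v$.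
   Formalization: The case n = k = 2 (the single edge K_2) is excluded: there the second multiplicative Zagreb index is 1, while the stated bound is 0^0·2^(-2) = 1/4 and the stated degree sequence would contain -1 twos. *)

theory Defs
  imports Main "HOL-Library.Multiset"
begin

text \<open>
  A finite simple graph is given by its vertex set \<open>V\<close> and its edge set \<open>E\<close>, an edge being a
  two-element set of vertices.
\<close>

definition simple_graph :: "'a set \<Rightarrow> 'a set set \<Rightarrow> bool" where
  "simple_graph V E \<longleftrightarrow> finite V \<and> (\<forall>e\<in>E. e \<subseteq> V \<and> card e = 2)"

definition degree :: "'a set set \<Rightarrow> 'a \<Rightarrow> nat" where
  "degree E v = card {e \<in> E. v \<in> e}"

definition subgraph :: "'a set \<Rightarrow> 'a set set \<Rightarrow> 'a set \<Rightarrow> 'a set set \<Rightarrow> bool" where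
  "subgraph W F V E \<longleftrightarrow> simple_graph W F \<and> W \<subseteq> V \<and> F \<subseteq> E"

definition connected_graph :: "'a set \<Rightarrow> 'a set set \<Rightarrow> bool" where
  "connected_graph V E \<longleftrightarrow>
     V \<noteq> {} \<and> (\<forall>u\<in>V. \<forall>v\<in>V. (u, v) \<in> {(x, y). {x, y} \<in> E}\<^sup>*)"

text \<open>
  Only used for connected graphs. The empty graph does not count as connected, so the vertex of
  the one-vertex graph has to be exempted explicitly.
\<close>

definition cut_vertex :: "'a set \<Rightarrow> 'a set set \<Rightarrow> 'a \<Rightarrow> bool" where
  "cut_vertex V E v \<longleftrightarrow>
     v \<in> V \<and> V - {v} \<noteq> {} \<and> \<not> connected_graph (V - {v}) {e \<in> E. v \<notin> e}"

definition nonseparable :: "'a set \<Rightarrow> 'a set set \<Rightarrow> bool" where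
  "nonseparable V E \<longleftrightarrow> connected_graph V E \<and> (\<forall>v. \<not> cut_vertex V E v)"

text \<open>
  Blocks are the maximal connected subgraphs without a cut vertex of their own. They are required
  to contain an edge: the one-vertex graph then has no block, and hence is a cactus, as
  every tree should be. In a connected graph with at least two vertices the requirement is
  automatic.
\<close>

definition block :: "'a set \<Rightarrow> 'a set set \<Rightarrow> 'a set \<Rightarrow> 'a set set \<Rightarrow> bool" where
  "block V E W F \<longleftrightarrow>
     subgraph W F V E \<and> F \<noteq> {} \<and> nonseparable W F \<and>
     (\<forall>W' F'. subgraph W' F' V E \<and> nonseparable W' F' \<and> W \<subseteq> W' \<and> F \<subseteq> F'
        \<longrightarrow> W' = W \<and> F' = F)"

definition edge_graph :: "'a set \<Rightarrow> 'a set set \<Rightarrow> bool" where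
  "edge_graph W F \<longleftrightarrow> (\<exists>u v. u \<noteq> v \<and> W = {u, v} \<and> F = {{u, v}})"

definition cycle_graph :: "'a set \<Rightarrow> 'a set set \<Rightarrow> bool" where
  "cycle_graph W F \<longleftrightarrow>
     (\<exists>vs. distinct vs \<and> length vs \<ge> 3 \<and> W = set vs \<and>
        F = {{vs ! i, vs ! ((i + 1) mod length vs)} | i. i < length vs})"

definition cactus :: "'a set \<Rightarrow> 'a set set \<Rightarrow> bool" where
  "cactus V E \<longleftrightarrow> simple_graph V E \<and> connected_graph V E \<and>
     (\<forall>W F. block V E W F \<longrightarrow> edge_graph W F \<or> cycle_graph W F)"

definition pendant_vertices :: "'a set \<Rightarrow> 'a set set \<Rightarrow> 'a set" where
  "pendant_vertices V E = {v \<in> V. degree E v = 1}"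

definition cacti :: "nat \<Rightarrow> nat \<Rightarrow> ('a set \<times> 'a set set) set" where
  "cacti n k = {(V, E). cactus V E \<and> card V = n \<and> card (pendant_vertices V E) = k}"

text \<open>For an edge \<open>e = {u, v}\<close> the inner product is \<open>d(u) d(v)\<close>.\<close>

definition second_mult_zagreb :: "'a set set \<Rightarrow> nat" where
  "second_mult_zagreb E = (\<Prod>e\<in>E. \<Prod>v\<in>e. degree E v)"

text \<open>The degree sequence, whose order is immaterial, is the multiset of all vertex degrees.\<close>

definition degree_sequence :: "'a set \<Rightarrow> 'a set set \<Rightarrow> nat multiset" where
  "degree_sequence V E = image_mset (degree E) (mset_set V)"

end

theory Submission
  imports Defs "HOL-Library.Product_Order"
begin

text \<open>
  Induction along cut vertices gives \<open>2|E| + k \<le> 3(n - 1)\<close> for every cactus other than \<open>K\<^sub>2\<close>.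
  By the handshake lemma the excesses \<open>d(v) - 2\<close> of the \<open>n - k\<close> non-pendant vertices add up to
  \<open>N - 2\<close>, where \<open>N = 2|E| - 2n + k + 2 \<le> n - 1\<close> and \<open>N \<equiv> k (mod 2)\<close>. As \<open>x\<^sup>x\<close> is strictly
  log-convex, moving the whole excess to a single vertex increases \<open>\<Prod> d(v)\<^bsup>d(v)\<^esup>\<close> to
  \<open>N\<^sup>N 4\<^bsup>n-k-1\<^esup>\<close>, and this is largest for the largest \<open>N\<close> of the right parity.
\<close>

section \<open>Degrees and connectivity\<close>

lemma simple_graph_finite_edges:
  assumes "simple_graph V E"
  shows "finite E"
proof (rule finite_subset)
  show "E \<subseteq> Pow V" using assms by (auto simp: simple_graph_def)
  show "finite (Pow V)" using assms by (auto simp: simple_graph_def)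
qed

lemma degree_mono:
  assumes "finite E" "F \<subseteq> E"
  shows "degree F v \<le> degree E v"
  unfolding degree_def using assms by (intro card_mono) auto

lemma handshake:
  assumes "simple_graph V E"
  shows "(\<Sum>v\<in>V. degree E v) = 2 * card E"
  unfolding degree_def
proof (rule sum_multicount)
  show "finite V" using assms by (auto simp: simple_graph_def)
  show "finite E" using assms by (rule simple_graph_finite_edges)
  have "{v \<in> V. v \<in> e} = e" if "e \<in> E" for e
    using assms that by (auto simp: simple_graph_def)
  then show "\<forall>e\<in>E. card {v \<in> V. v \<in> e} = 2"
    using assms by (simp add: simple_graph_def)
qed

text \<open>Counting incident pairs: the factor \<open>degree E v\<close> occurs once for each edge
  at \<open>v\<close>, so swapping the two products collects it into a power.\<close>

lemma second_mult_zagreb_vertices: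
  assumes "simple_graph V E"
  shows "second_mult_zagreb E = (\<Prod>v\<in>V. degree E v ^ degree E v)"
proof -
  have fin: "finite V" "finite E"
    using assms simple_graph_finite_edges[OF assms] by (auto simp: simple_graph_def)
  have "(\<Prod>e\<in>E. \<Prod>v\<in>e. degree E v) = (\<Prod>e\<in>E. \<Prod>v | v \<in> V \<and> v \<in> e. degree E v)"
    using assms by (intro prod.cong refl) (auto simp: simple_graph_def)
  also have "\<dots> = (\<Prod>v\<in>V. \<Prod>e | e \<in> E \<and> v \<in> e. degree E v)"
    using fin by (intro prod.swap_restrict) auto
  finally show ?thesis
    by (simp add: second_mult_zagreb_def degree_def)
qed

text \<open>A path that starts in \<open>A\<close> can never leave it. Connectivity can thus be
  exploited by exhibiting a set closed under adjacency.\<close>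

lemma connected_graph_closed_set:
  assumes conn: "connected_graph V E" and "a \<in> A" "a \<in> V"
    and closed: "\<And>x y. x \<in> A \<Longrightarrow> {x, y} \<in> E \<Longrightarrow> y \<in> A"
  shows "V \<subseteq> A"
proof
  fix b assume "b \<in> V"
  then have "(a, b) \<in> {(x, y). {x, y} \<in> E}\<^sup>*"
    using conn \<open>a \<in> V\<close> by (auto simp: connected_graph_def)
  then show "b \<in> A"
    by (induction rule: rtrancl_induct) (use \<open>a \<in> A\<close> closed in auto)
qed

text \<open>If no edge meets \<open>v\<close>, then \<open>{v}\<close> is closed under adjacency and
  exhausts the vertex set.\<close>

lemma connected_graph_degree_pos:
  assumes "simple_graph V E" "connected_graph V E" "v \<in> V" "V \<noteq> {v}"
  shows "degree E v \<ge> 1"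
proof (rule ccontr)
  assume "\<not> degree E v \<ge> 1"
  then have "degree E v = 0" by simp
  then have "{e \<in> E. v \<in> e} = {}"
    using simple_graph_finite_edges[OF assms(1)] by (simp add: degree_def)
  then have "V \<subseteq> {v}"
    using assms by (intro connected_graph_closed_set[of V E v]) auto
  with assms show False by auto
qed

text \<open>Two pendant vertices joined by an edge form a whole component, so they would be all of
  \<open>V\<close>. The main argument needs a non-pendant vertex to carry the excess.\<close>

lemma connected_graph_nonpendant:
  assumes "simple_graph V E" "connected_graph V E" "card V \<ge> 3"
  shows "pendant_vertices V E \<noteq> V"
proof
  assume pend: "pendant_vertices V E = V"
  obtain v where v: "v \<in> V" using assms(2) by (auto simp: connected_graph_def)
  have deg: "card {e \<in> E. x \<in> e} = 1" if "x \<in> V" for x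
    using that pend unfolding pendant_vertices_def degree_def by blast
  have unique: "f = g" if "x \<in> V" "f \<in> E" "x \<in> f" "g \<in> E" "x \<in> g" for x f g
  proof -
    obtain h where "{e \<in> E. x \<in> e} = {h}" using deg[OF \<open>x \<in> V\<close>] by (rule card_1_singletonE)
    then have "f \<in> {h}" "g \<in> {h}" using that(2-5) by blast+
    then show ?thesis by simp
  qed
  obtain e where "{f \<in> E. v \<in> f} = {e}" using deg[OF v] by (rule card_1_singletonE)
  then have "e \<in> E" "v \<in> e" by blast+
  then have card_e: "card e = 2" "e \<subseteq> V" using assms(1) by (auto simp: simple_graph_def)
  have "V \<subseteq> e"
  proof (rule connected_graph_closed_set[OF assms(2) \<open>v \<in> e\<close> v])
    fix x y assume "x \<in> e" "{x, y} \<in> E"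
    then have "{x, y} = e" using unique[of x "{x, y}" e] \<open>e \<in> E\<close> card_e(2) by blast
    then show "y \<in> e" by blast
  qed
  moreover have "finite e" using card_e(1) by (metis card.infinite zero_neq_numeral)
  ultimately have "card V \<le> 2" using card_e(1) card_mono[of e V] by simp
  with assms(3) show False by simp
qed

section \<open>Edges and pendant vertices of a cactus\<close>

text \<open>Take a maximal pair above \<open>(W, F)\<close> in the finite set of nonseparable
  subgraphs. Pairs are ordered componentwise, which matches the maximality clause of
  \<open>block\<close>.\<close>

lemma nonseparable_subgraph_in_block:
  assumes "simple_graph V E" "subgraph W F V E" "nonseparable W F" "F \<noteq> {}"
  obtains W' F' where "block V E W' F'" "F \<subseteq> F'"
proof -
  define P where "P = {(W', F'). subgraph W' F' V E \<and> nonseparable W' F'}"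
  have "finite V" "finite E"
    using assms simple_graph_finite_edges[OF assms(1)] by (auto simp: simple_graph_def)
  moreover have "P \<subseteq> Pow V \<times> Pow E" by (auto simp: P_def subgraph_def)
  ultimately have "finite P" by (meson finite_SigmaI finite_Pow_iff finite_subset)
  moreover have "(W, F) \<in> P" using assms by (simp add: P_def)
  ultimately obtain W' F' where max: "(W', F') \<in> P" "(W, F) \<le> (W', F')"
    "\<And>q. q \<in> P \<Longrightarrow> (W', F') \<le> q \<Longrightarrow> (W', F') = q"
    using finite_has_maximal2[of P "(W, F)"] by (metis prod.exhaust_sel)
  then have "F \<subseteq> F'" by simp
  moreover have "block V E W' F'"
    unfolding block_def
  proof (intro conjI allI impI)
    show "subgraph W' F' V E" "nonseparable W' F'" using max(1) by (auto simp: P_def)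
    show "F' \<noteq> {}" using \<open>F \<subseteq> F'\<close> \<open>F \<noteq> {}\<close> by blast
    fix W'' F''
    assume "subgraph W'' F'' V E \<and> nonseparable W'' F'' \<and> W' \<subseteq> W'' \<and> F' \<subseteq> F''"
    then have "(W', F') = (W'', F'')" by (intro max(3)) (auto simp: P_def)
    then show "W'' = W'" "F'' = F'" by auto
  qed
  ultimately show thesis using that by blast
qed

text \<open>The vertex at position \<open>j\<close> lies only on the edges leaving \<open>j\<close>
  and its cyclic predecessor; a vertex off the cycle lies on none.\<close>

lemma cycle_graph_degree_le:
  assumes "cycle_graph W F"
  shows "degree F v \<le> 2"
proof -
  obtain vs where vs: "distinct vs" "length vs \<ge> 3"
    "F = {{vs ! i, vs ! ((i + 1) mod length vs)} | i. i < length vs}"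
    using assms by (auto simp: cycle_graph_def)
  define n where "n = length vs"
  show ?thesis
  proof (cases "v \<in> set vs")
    case False
    have "(i + 1) mod length vs < length vs" for i using vs(2) by (intro mod_less_divisor) linarith
    then have "e \<subseteq> set vs" if "e \<in> F" for e using that vs(3) by (auto intro!: nth_mem)
    then have none: "{e \<in> F. v \<in> e} = {}" using False by blast
    show ?thesis unfolding degree_def none by simp
  next
    case True
    then obtain j where j: "j < n" "v = vs ! j" by (auto simp: in_set_conv_nth n_def)
    define e where "e i = {vs ! i, vs ! ((i + 1) mod n)}" for i
    \<comment> \<open>\<open>(j + n - 1) mod n\<close> is the cyclic predecessor of
      \<open>j\<close>; adding \<open>n\<close> first avoids truncation at
      \<open>j = 0\<close>.\<close>
    have "{f \<in> F. v \<in> f} \<subseteq> {e j, e ((j + n - 1) mod n)}"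
    proof
      fix f assume "f \<in> {f \<in> F. v \<in> f}"
      then obtain i where i: "i < n" "f = e i" "v \<in> f" by (auto simp: vs(3) e_def n_def)
      have lt: "(i + 1) mod n < n" using i by simp
      have "j = i \<or> j = (i + 1) mod n"
        using i lt j vs(1) by (auto simp: e_def n_def nth_eq_iff_index_eq)
      moreover have "i = (j + n - 1) mod n" if "j = (i + 1) mod n"
        using that i by (cases "i + 1 = n") auto
      ultimately show "f \<in> {e j, e ((j + n - 1) mod n)}" unfolding i(2) by (metis insert_iff)
    qed
    then have "degree F v \<le> card {e j, e ((j + n - 1) mod n)}"
      unfolding degree_def by (intro card_mono) auto
    also have "\<dots> \<le> 2" by (simp add: card_insert_if)
    finally show ?thesis .
  qed
qed

text \<open>Any nonseparable subgraph with an edge lies in a block, hence in an edge or a cycle. In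
  this form the cactus condition passes to subgraphs without comparing blocks, as the induction
  along cut vertices requires.\<close>

lemma cactus_nonseparable_degree_le:
  assumes "cactus V E" "subgraph W F V E" "nonseparable W F"
  shows "degree F v \<le> 2"
proof (cases "F = {}")
  case True
  then show ?thesis by (simp add: degree_def)
next
  case False
  have simple: "simple_graph V E" using assms by (simp add: cactus_def)
  then obtain W' F' where blk: "block V E W' F'" "F \<subseteq> F'"
    using nonseparable_subgraph_in_block assms False by metis
  then have "edge_graph W' F' \<or> cycle_graph W' F'" using assms by (simp add: cactus_def)
  then have "degree F' v \<le> 2"
  proof
    assume "edge_graph W' F'"
    then obtain a b where "F' = {{a, b}}" by (auto simp: edge_graph_def)
    then have "degree F' v \<le> card {{a, b}}" unfolding degree_def by (intro card_mono) auto
    then show ?thesis by simp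
  qed (rule cycle_graph_degree_le)
  moreover have "finite F'"
    using blk by (auto simp: block_def subgraph_def intro: simple_graph_finite_edges)
  ultimately show ?thesis using degree_mono[of F' F v] blk by simp
qed

section \<open>Tiny graphs and the pendant count\<close>

lemma simple_graph_card_2:
  assumes "simple_graph V E" "card V = 2"
  shows "E \<subseteq> {V}"
proof
  fix e assume "e \<in> E"
  then have "e \<subseteq> V" "card e = 2" "finite V" using assms by (auto simp: simple_graph_def)
  then show "e \<in> {V}" using assms card_subset_eq[of V e] by simp
qed

lemma simple_graph_card_1:
  assumes "simple_graph V E" "card V = 1"
  shows "E = {}"
proof (rule ccontr)
  assume "E \<noteq> {}"
  then obtain e where "e \<in> E" by auto
  then have "e \<subseteq> V" "card e = 2" "finite V" using assms by (auto simp: simple_graph_def)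
  then show False using assms card_mono[of V e] by simp
qed

text \<open>As a sum of indicators, the count can be added termwise to the handshake sum.\<close>

lemma card_pendant_vertices:
  assumes "finite V"
  shows "card (pendant_vertices V E) = (\<Sum>v\<in>V. if degree E v = 1 then 1 else 0)"
proof -
  have "(\<Sum>v\<in>V. if degree E v = 1 then 1 else (0::nat)) = (\<Sum>v\<in>{v \<in> V. degree E v = 1}. 1)"
    using assms by (rule sum.inter_filter[symmetric])
  then show ?thesis by (simp add: pendant_vertices_def)
qed

section \<open>Splitting at a cut vertex\<close>

text \<open>A path from a vertex of \<open>B\<close> to \<open>v\<close> stays inside
  \<open>insert v B\<close> up to its first visit to \<open>v\<close>, by
  \<open>closed\<close>.\<close>

lemma connected_graph_attach:
  assumes conn: "connected_graph V E" and "v \<in> V" "B \<subseteq> V"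
    and closed: "\<And>e. e \<in> E \<Longrightarrow> e \<inter> B \<noteq> {} \<Longrightarrow> e \<subseteq> insert v B"
  shows "connected_graph (insert v B) {e \<in> E. e \<subseteq> insert v B}"
proof -
  define R where "R = {(x, y). {x, y} \<in> {e \<in> E. e \<subseteq> insert v B}}"
  have sym: "sym (R\<^sup>*)"
    by (rule sym_rtrancl) (auto simp: R_def sym_def insert_commute)
  have to_v: "(x, v) \<in> R\<^sup>*" if "x \<in> insert v B" for x
  proof -
    have "x \<in> V" using that assms by auto
    then have "(x, v) \<in> {(x, y). {x, y} \<in> E}\<^sup>*"
      using conn \<open>v \<in> V\<close> by (auto simp: connected_graph_def)
    then show ?thesis using that
    proof (induction rule: converse_rtrancl_induct)
      case (step x y)
      show ?case
      proof (cases "x = v")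
        case False
        then have "{x, y} \<subseteq> insert v B" using step closed[of "{x, y}"] by auto
        then have "(x, y) \<in> R" "(y, v) \<in> R\<^sup>*" using step by (auto simp: R_def)
        then show ?thesis by (rule converse_rtrancl_into_rtrancl)
      qed simp
    qed simp
  qed
  have "(x, y) \<in> R\<^sup>*" if "x \<in> insert v B" "y \<in> insert v B" for x y
    using to_v[OF that(1)] to_v[OF that(2)] sym by (meson rtrancl_trans symD)
  then show ?thesis by (auto simp: connected_graph_def R_def)
qed

text \<open>\<open>A\<close> is what can be reached from \<open>a\<close> without passing through
  \<open>v\<close>, and \<open>B\<close> is the rest; both are unions of components of the graph
  minus \<open>v\<close>.\<close>

lemma cut_vertex_split:
  assumes "simple_graph V E" "connected_graph V E" "cut_vertex V E v"
  obtains A B where "V = insert v (A \<union> B)" "v \<notin> A" "v \<notin> B" "A \<inter> B = {}" "A \<noteq> {}" "B \<noteq> {}"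
    "\<And>e. e \<in> E \<Longrightarrow> e \<inter> A \<noteq> {} \<Longrightarrow> e \<subseteq> insert v A"
    "\<And>e. e \<in> E \<Longrightarrow> e \<inter> B \<noteq> {} \<Longrightarrow> e \<subseteq> insert v B"
proof -
  define R where "R = {(x, y). {x, y} \<in> {e \<in> E. v \<notin> e}}"
  have v: "v \<in> V" using assms by (simp add: cut_vertex_def)
  obtain a b where ab: "a \<in> V" "a \<noteq> v" "b \<in> V" "b \<noteq> v" "(a, b) \<notin> R\<^sup>*"
    using assms by (auto simp: cut_vertex_def connected_graph_def R_def)
  define A where "A = {x \<in> V - {v}. (a, x) \<in> R\<^sup>*}"
  define B where "B = V - {v} - A"
  have closed: "e \<subseteq> insert v A" if "e \<in> E" "e \<inter> A \<noteq> {}" for e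
  proof
    fix y assume "y \<in> e"
    obtain x where x: "x \<in> e" "x \<in> A" using \<open>e \<inter> A \<noteq> {}\<close> by blast
    have e: "card e = 2" "e \<subseteq> V" using assms that by (auto simp: simple_graph_def)
    show "y \<in> insert v A"
    proof (cases "y = v \<or> y = x")
      case False
      then have "e = {x, y}"
        using e x \<open>y \<in> e\<close> by (auto simp: card_2_iff)
      then have "(x, y) \<in> R" using that x False by (auto simp: R_def A_def)
      then show ?thesis using x e \<open>y \<in> e\<close> by (auto simp: A_def intro: rtrancl_into_rtrancl)
    qed (use x in auto)
  qed
  show thesis
  proof
    show "V = insert v (A \<union> B)" using v by (auto simp: A_def B_def)
    show "A \<noteq> {}" "B \<noteq> {}" using ab by (auto simp: A_def B_def)
    show "e \<subseteq> insert v B" if "e \<in> E" "e \<inter> B \<noteq> {}" for e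
    proof -
      have "e \<inter> A = {}" using closed[of e] that by (auto simp: B_def)
      moreover have "e \<subseteq> V" using assms that by (auto simp: simple_graph_def)
      ultimately show ?thesis by (auto simp: B_def)
    qed
  qed (use closed in \<open>auto simp: A_def B_def\<close>)
qed

text \<open>
  Splitting at a cut vertex \<open>v\<close> is additive once \<open>v\<close> is not counted as a pendant vertex of either
  part. This also takes care of parts with two vertices, which violate the bound only because
  both of their vertices are pendant.
\<close>

lemma edges_pendant_bound:
  assumes "simple_graph V E" "connected_graph V E" "card V \<noteq> 2"
    and "\<And>W F u. subgraph W F V E \<Longrightarrow> nonseparable W F \<Longrightarrow> degree F u \<le> 2"
  shows "2 * card E + card (pendant_vertices V E) + 3 \<le> 3 * card V"
  using assms
proof (induction "card V" arbitrary: V E rule: less_induct)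
  case less
  note simple = less.prems(1) and conn = less.prems(2) and deg = less.prems(4)
  have fin: "finite V" "finite E" "V \<noteq> {}"
    using simple conn simple_graph_finite_edges[OF simple]
    by (auto simp: simple_graph_def connected_graph_def)
  show ?case
  proof (cases "\<exists>v. cut_vertex V E v")
    case False
    show ?thesis
    proof (cases "card V = 1")
      case True
      then have "E = {}" using simple simple_graph_card_1 by auto
      then show ?thesis using True by (simp add: pendant_vertices_def degree_def)
    next
      case ne1: False
      have "card V \<noteq> 0" using fin by simp
      then have three: "card V \<ge> 3" using less.prems(3) ne1 by linarith
      \<comment> \<open>Without a cut vertex the graph is a nonseparable subgraph of itself, so all
        degrees are at most 2, and a pendant vertex has room for its indicator.\<close>
      have "subgraph V E V E" "nonseparable V E"
        using simple conn False by (auto simp: subgraph_def nonseparable_def)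
      then have "degree E u \<le> 2" for u by (rule deg)
      then have "degree E u + (if degree E u = 1 then 1 else 0) \<le> 2" for u
        by simp
      then have "(\<Sum>u\<in>V. degree E u + (if degree E u = 1 then 1 else 0)) \<le> card V * 2"
        using sum_bounded_above[of V "\<lambda>u. degree E u + (if degree E u = 1 then 1 else 0)" 2]
        by simp
      then have "2 * card E + card (pendant_vertices V E) \<le> 2 * card V"
        unfolding sum.distrib handshake[OF simple] card_pendant_vertices[OF fin(1)] by simp
      \<comment> \<open>\<open>2 * card V + 3 \<le> 3 * card V\<close> holds from three vertices
        on.\<close>
      then show ?thesis using three by linarith
    qed
  next
    case True
    then obtain v where cut: "cut_vertex V E v" by auto
    obtain A B where AB: "V = insert v (A \<union> B)" "v \<notin> A" "v \<notin> B" "A \<inter> B = {}" "A \<noteq> {}" "B \<noteq> {}"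
      "\<And>e. e \<in> E \<Longrightarrow> e \<inter> A \<noteq> {} \<Longrightarrow> e \<subseteq> insert v A"
      "\<And>e. e \<in> E \<Longrightarrow> e \<inter> B \<noteq> {} \<Longrightarrow> e \<subseteq> insert v B"
      using cut_vertex_split[OF simple conn cut] by blast
    define part where "part C = {e \<in> E. e \<subseteq> insert v C}" for C
    have finAB: "finite A" "finite B" using fin(1) AB(1) by auto
    have part_simple: "simple_graph (insert v C) (part C)" if "C \<subseteq> V" for C
      using simple that fin(1) by (auto simp: simple_graph_def part_def intro: finite_subset)
    \<comment> \<open>The bound for one side, where \<open>3 * card C\<close> is three times the
      vertex number of the part minus 3. The degree claim serves to show that \<open>v\<close> is
      not pendant in the whole graph.\<close>
    have part_bound: "degree (part C) v \<ge> 1 \<and>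
        2 * card (part C) + card (pendant_vertices (insert v C) (part C) - {v}) \<le> 3 * card C"
      if C: "C \<subseteq> V" "v \<notin> C" "C \<noteq> {}" "card (insert v C) < card V"
        "\<And>e. e \<in> E \<Longrightarrow> e \<inter> C \<noteq> {} \<Longrightarrow> e \<subseteq> insert v C" for C
    proof -
      have finC: "finite C" using fin(1) C(1) by (rule rev_finite_subset)
      have cardC: "card (insert v C) = card C + 1" using finC C(2) by simp
      have "v \<in> V" using AB(1) by simp
      have connC: "connected_graph (insert v C) (part C)"
        unfolding part_def using conn \<open>v \<in> V\<close> C by (intro connected_graph_attach) auto
      note simpleC = part_simple[OF C(1)]
      have "degree (part C) v \<ge> 1"
        using simpleC connC C by (intro connected_graph_degree_pos) auto
      moreover have "2 * card (part C) + card (pendant_vertices (insert v C) (part C) - {v})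
          \<le> 3 * card C"
      proof (cases "card (insert v C) = 2")
        case True
        \<comment> \<open>A part with two vertices contributes at most 2 for its edge and 1 for its
          end other than \<open>v\<close>, which is just \<open>3 * card C\<close>.\<close>
        have "card (part C) \<le> 1"
          using card_mono[OF _ simple_graph_card_2[OF simpleC True]] by simp
        moreover have "card (pendant_vertices (insert v C) (part C) - {v}) \<le> card C"
          using finC by (intro card_mono) (auto simp: pendant_vertices_def)
        ultimately show ?thesis using True cardC by simp
      next
        case False
        have "2 * card (part C) + card (pendant_vertices (insert v C) (part C)) + 3
            \<le> 3 * card (insert v C)"
        proof (rule less.hyps[OF C(4) simpleC connC False])
          fix W F u assume "subgraph W F (insert v C) (part C)" and ns: "nonseparable W F"
          then have "subgraph W F V E"
            using \<open>v \<in> V\<close> C(1) by (auto simp: subgraph_def part_def)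
          then show "degree F u \<le> 2" using ns by (rule deg)
        qed
        moreover have "card (pendant_vertices (insert v C) (part C) - {v})
            \<le> card (pendant_vertices (insert v C) (part C))"
          using finC by (intro card_mono) (auto simp: pendant_vertices_def)
        ultimately show ?thesis using cardC by simp
      qed
      ultimately show ?thesis by simp
    qed
    have cardV: "card V = card A + card B + 1"
      using AB finAB by (simp add: card_Un_disjoint)
    have "card A > 0" "card B > 0" using AB finAB by auto
    then have lt: "card (insert v A) < card V" "card (insert v B) < card V"
      using cardV AB finAB by auto
    have boundA: "degree (part A) v \<ge> 1"
      "2 * card (part A) + card (pendant_vertices (insert v A) (part A) - {v}) \<le> 3 * card A"
      using part_bound[of A] AB lt by auto
    have boundB: "degree (part B) v \<ge> 1"
      "2 * card (part B) + card (pendant_vertices (insert v B) (part B) - {v}) \<le> 3 * card B"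
      using part_bound[of B] AB lt by auto
    have E_split: "E = part A \<union> part B"
    proof -
      have "e \<in> part A \<union> part B" if "e \<in> E" for e
      proof -
        have "e \<subseteq> V" "card e = 2" using simple that by (auto simp: simple_graph_def)
        have "e \<noteq> {v}" "e \<noteq> {}" using \<open>card e = 2\<close> by auto
        then have "e \<inter> A \<noteq> {} \<or> e \<inter> B \<noteq> {}" using \<open>e \<subseteq> V\<close> AB(1) by blast
        then show ?thesis using AB(7,8) that by (auto simp: part_def)
      qed
      then show ?thesis by (auto simp: part_def)
    qed
    \<comment> \<open>An edge in both parts would lie inside \<open>{v}\<close>.\<close>
    have disj: "part A \<inter> part B = {}"
    proof -
      have False if "e \<in> part A" "e \<in> part B" for e
      proof -
        have "e \<subseteq> {v}" using that AB(2-4) by (auto simp: part_def)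
        then have "card e \<le> 1" using card_mono[of "{v}" e] by simp
        moreover have "card e = 2" using that simple by (auto simp: simple_graph_def part_def)
        ultimately show False by simp
      qed
      then show ?thesis by auto
    qed
    have fin_parts: "finite (part A)" "finite (part B)" using fin by (auto simp: part_def)
    have cardE: "card E = card (part A) + card (part B)"
      using E_split disj fin_parts by (metis card_Un_disjoint)
    have "{e \<in> E. v \<in> e} = {e \<in> part A. v \<in> e} \<union> {e \<in> part B. v \<in> e}" using E_split by blast
    moreover have "{e \<in> part A. v \<in> e} \<inter> {e \<in> part B. v \<in> e} = {}" using disj by blast
    ultimately have "degree E v = degree (part A) v + degree (part B) v"
      using fin_parts by (simp add: degree_def card_Un_disjoint)
    \<comment> \<open>Having an edge on each side, \<open>v\<close> is not pendant, so leaving it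
      out of both pendant counts loses nothing.\<close>
    then have v_not_pendant: "degree E v \<noteq> 1" using boundA boundB by linarith
    have degA: "degree E u = degree (part A) u" if "u \<in> A" for u
    proof -
      have "{e \<in> E. u \<in> e} = {e \<in> part A. u \<in> e}" using AB(7) that by (auto simp: part_def)
      then show ?thesis by (simp add: degree_def)
    qed
    have degB: "degree E u = degree (part B) u" if "u \<in> B" for u
    proof -
      have "{e \<in> E. u \<in> e} = {e \<in> part B. u \<in> e}" using AB(8) that by (auto simp: part_def)
      then show ?thesis by (simp add: degree_def)
    qed
    have "pendant_vertices V E \<subseteq> (pendant_vertices (insert v A) (part A) - {v})
        \<union> (pendant_vertices (insert v B) (part B) - {v})"
      using v_not_pendant AB degA degB by (auto simp: pendant_vertices_def)
    then have "card (pendant_vertices V E)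
        \<le> card ((pendant_vertices (insert v A) (part A) - {v})
          \<union> (pendant_vertices (insert v B) (part B) - {v}))"
      using finAB by (intro card_mono) (auto simp: pendant_vertices_def)
    also have "\<dots> \<le> card (pendant_vertices (insert v A) (part A) - {v})
        + card (pendant_vertices (insert v B) (part B) - {v})"
      by (rule card_Un_le)
    finally show ?thesis using boundA boundB cardE cardV by linarith
  qed
qed

section \<open>Log-convexity of the self-power\<close>

text \<open>Bernoulli's inequality for \<open>(1 + y/x) ^ m\<close>, multiplied by
  \<open>x ^ (m + 1)\<close> to avoid division.\<close>

lemma bernoulli_nat: "x ^ m * (x + m * y) \<le> x * (x + y) ^ m" for x y m :: nat
proof (induction m)
  case (Suc m)
  \<comment> \<open>The two sides differ by \<open>m * x ^ m * y ^ 2\<close>.\<close>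
  have "x ^ Suc m * (x + Suc m * y) \<le> x ^ m * (x + m * y) * (x + y)"
    by (simp add: algebra_simps)
  also have "\<dots> \<le> x * (x + y) ^ m * (x + y)" using Suc by (rule mult_right_mono) simp
  finally show ?case by (simp add: algebra_simps)
qed simp

text \<open>Two excesses \<open>a\<close> and \<open>b\<close> are merged at one vertex and the
  other drops to degree 2, whence the factor \<open>4 = 2 ^ 2\<close>. Two applications of Bernoulli
  reduce the claim to a cubic inequality in the smaller excess.\<close>

lemma self_power_merge_less:
  fixes a b :: nat
  assumes "a \<ge> 1" "b \<ge> 1"
  shows "(a + 2) ^ (a + 2) * (b + 2) ^ (b + 2) < 4 * (a + b + 2) ^ (a + b + 2)"
  using assms
proof (induction b a rule: linorder_wlog)
  case (le b a)
  \<comment> \<open>Here \<open>b\<close> is the smaller excess, and \<open>s + b\<close> is the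
    merged degree. Its power is split as \<open>(s + b) ^ s * (s + b) ^ b\<close>, and each factor
    is bounded from below.\<close>
  define s t where "s = a + 2" and "t = b + 2"
  then have "s > 0" "t > 0" "t + b \<le> s + b" using le by auto
  have "s * (s ^ s * (1 + b)) \<le> s * (s + b) ^ s"
    using bernoulli_nat[of s s b] by (simp add: algebra_simps)
  then have left: "s ^ s * (1 + b) \<le> (s + b) ^ s" using \<open>s > 0\<close> by (simp only: mult_le_cancel1)
  have "t ^ b * (t + b * b) \<le> t * (t + b) ^ b" by (rule bernoulli_nat)
  also have "\<dots> \<le> t * (s + b) ^ b" using \<open>t + b \<le> s + b\<close> by (intro mult_left_mono power_mono) auto
  finally have right: "t ^ b * (t + b * b) \<le> t * (s + b) ^ b" .
  \<comment> \<open>With \<open>t = b + 2\<close> the difference is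
    \<open>3 * b ^ 3 + 2 * b ^ 2\<close>, positive because \<open>b \<ge> 1\<close>.\<close>
  have "t ^ 3 < 4 * ((1 + b) * (t + b * b))"
    using le by (simp add: t_def power3_eq_cube algebra_simps)
  then have "s ^ s * t ^ b * t ^ 3 < s ^ s * t ^ b * (4 * ((1 + b) * (t + b * b)))"
    using \<open>s > 0\<close> \<open>t > 0\<close> by (intro mult_strict_left_mono) auto
  also have "\<dots> = 4 * ((s ^ s * (1 + b)) * (t ^ b * (t + b * b)))" by (simp add: algebra_simps)
  also have "\<dots> \<le> 4 * ((s + b) ^ s * (t * (s + b) ^ b))"
    using mult_le_mono[OF left right] by (rule mult_left_mono) simp
  also have "\<dots> = t * (4 * (s + b) ^ (s + b))" by (simp add: power_add algebra_simps)
  finally have "t * (s ^ s * (t ^ b * t ^ 2)) < t * (4 * (s + b) ^ (s + b))"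
    by (simp add: power3_eq_cube power2_eq_square algebra_simps)
  then have "s ^ s * t ^ (b + 2) < 4 * (s + b) ^ (s + b)"
    using \<open>t > 0\<close> unfolding power_add by (simp only: mult_less_cancel1)
  moreover have "s + b = a + b + 2" by (simp add: s_def)
  ultimately show ?case unfolding s_def[symmetric] t_def[symmetric] by simp
next
  case (sym b a)
  then show ?case by (simp add: add.commute mult.commute)
qed

text \<open>Strictness starts at 1, as \<open>0 ^ 0 = 1 ^ 1\<close>.\<close>

lemma self_power_strict_mono:
  fixes x y :: nat
  assumes "1 \<le> x" "x < y"
  shows "x ^ x < y ^ y"
proof -
  have "x ^ x < y ^ x" using assms by (intro power_strict_mono) auto
  also have "\<dots> \<le> y ^ y" using assms by (intro power_increasing) auto
  finally show ?thesis .
qed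

text \<open>Induction on \<open>S\<close>: the new vertex is merged with a single vertex of degree
  \<open>M\<close> carrying the excess so far. The summand 2 in \<open>N\<close> is the degree that
  remains when there is no excess.\<close>

lemma prod_self_power_le:
  fixes f :: "'a \<Rightarrow> nat"
  assumes "finite S" "S \<noteq> {}" "\<And>v. v \<in> S \<Longrightarrow> f v \<ge> 2"
    and "N = 2 + (\<Sum>v\<in>S. f v - 2)"
  shows "(\<Prod>v\<in>S. f v ^ f v) \<le> N ^ N * 4 ^ (card S - 1) \<and>
    ((\<Prod>v\<in>S. f v ^ f v) = N ^ N * 4 ^ (card S - 1) \<longrightarrow>
      image_mset f (mset_set S) = {#N#} + replicate_mset (card S - 1) 2)"
  using assms
proof (induction S arbitrary: N rule: finite_ne_induct)
  case (singleton x)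
  then have "N = f x" by auto
  then show ?case by simp
next
  case (insert x S)
  define M where "M = 2 + (\<Sum>v\<in>S. f v - 2)"
  define P where "P = (\<Prod>v\<in>S. f v ^ f v)"
  have IH: "P \<le> M ^ M * 4 ^ (card S - 1)"
    "P = M ^ M * 4 ^ (card S - 1) \<Longrightarrow>
      image_mset f (mset_set S) = {#M#} + replicate_mset (card S - 1) 2"
    using insert.IH[OF _ M_def] insert.prems by (auto simp: P_def)
  have "f x \<ge> 2" using insert.prems by simp
  moreover have "N = 2 + ((f x - 2) + (\<Sum>v\<in>S. f v - 2))" using insert by simp
  ultimately have N: "N + 2 = M + f x" by (simp add: M_def)
  have pos: "card S \<ge> 1" using insert by (simp add: Suc_le_eq card_gt_0_iff)
  then have pow4: "(4::nat) ^ card S = 4 * 4 ^ (card S - 1)"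
    by (metis Suc_diff_1 Suc_le_eq One_nat_def power_Suc)
  have prod: "(\<Prod>v\<in>insert x S. f v ^ f v) = f x ^ f x * P" using insert by (simp add: P_def)
  have card: "card (insert x S) - 1 = card S" using insert by simp
  have mset: "image_mset f (mset_set (insert x S)) = {#f x#} + image_mset f (mset_set S)"
    using insert by simp
  have rep: "replicate_mset (card S) 2 = {#2#} + replicate_mset (card S - 1) (2::nat)"
    using pos by (metis Suc_diff_1 Suc_le_eq One_nat_def replicate_mset_Suc add_mset_add_single add.commute)
  have upper: "f x ^ f x * P \<le> (f x ^ f x * M ^ M) * 4 ^ (card S - 1)"
    using IH(1) by simp
  \<comment> \<open>If one of the two degrees is 2, merging changes nothing and the equality case is
    inherited from \<open>S\<close>. If both exceed 2, merging is strict and equality is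
    impossible.\<close>
  consider "f x = 2" | "M = 2" | "f x > 2" "M > 2"
    using \<open>f x \<ge> 2\<close> by (fastforce simp: M_def)
  then show ?case
  proof cases
    case 1
    then have "N = M" using N by simp
    have "image_mset f (mset_set (insert x S)) = {#N#} + replicate_mset (card S) 2"
      if "P = M ^ M * 4 ^ (card S - 1)"
      using IH(2)[OF that] 1 \<open>N = M\<close> by (simp add: mset rep)
    then show ?thesis unfolding prod card using IH(1) 1 \<open>N = M\<close> by (auto simp: pow4)
  next
    case 2
    then have "N = f x" using N by simp
    have "image_mset f (mset_set (insert x S)) = {#N#} + replicate_mset (card S) 2"
      if "P = M ^ M * 4 ^ (card S - 1)"
      using IH(2)[OF that] 2 \<open>N = f x\<close> by (simp add: mset rep)
    then show ?thesis
      unfolding prod card using IH(1) 2 \<open>N = f x\<close> \<open>f x \<ge> 2\<close> by (auto simp: pow4)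
  next
    case 3
    have "f x ^ f x * M ^ M < 4 * N ^ N"
    proof -
      have "f x - 2 + 2 = f x" "M - 2 + 2 = M" "(f x - 2) + (M - 2) + 2 = N" using N 3 by auto
      moreover have "f x - 2 \<ge> 1" "M - 2 \<ge> 1" using 3 by auto
      ultimately show ?thesis using self_power_merge_less[of "f x - 2" "M - 2"] by metis
    qed
    then have "(f x ^ f x * M ^ M) * 4 ^ (card S - 1) < 4 * N ^ N * 4 ^ (card S - 1)"
      by (rule mult_strict_right_mono) simp
    also have "\<dots> = N ^ N * 4 ^ card S" by (simp add: pow4)
    finally have "f x ^ f x * P < N ^ N * 4 ^ card S" using upper by (rule le_less_trans[rotated])
    then show ?thesis unfolding prod card by simp
  qed
qed

section \<open>The extremal bound\<close>

text \<open>The excluded pair \<open>(2, 2)\<close> belongs to the single edge: both sides of the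
  bound are then 1 by \<open>0 ^ 0 = 1\<close> and truncation in \<open>n - k - 1\<close>, while the
  stated degree sequence would have three entries.\<close>

theorem theorem5:
  fixes n k :: nat and V :: "'a set" and E :: "'a set set"
  assumes "n \<ge> k"
    and "(n, k) \<noteq> (2, 2)"
    and "(V, E) \<in> cacti n k"
  shows "second_mult_zagreb E \<le>
           (if even (n - k) then (n - 2) ^ (n - 2) * 2 ^ (2 * (n - k - 1))
            else (n - 1) ^ (n - 1) * 2 ^ (2 * (n - k - 1))) \<and>
         (even (n - k) \<longrightarrow>
           (second_mult_zagreb E = (n - 2) ^ (n - 2) * 2 ^ (2 * (n - k - 1)) \<longleftrightarrow>
            degree_sequence V E =
              {#n - 2#} + replicate_mset (n - k - 1) 2 + replicate_mset k 1)) \<and>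
         (odd (n - k) \<longrightarrow>
           (second_mult_zagreb E = (n - 1) ^ (n - 1) * 2 ^ (2 * (n - k - 1)) \<longleftrightarrow>
            degree_sequence V E =
              {#n - 1#} + replicate_mset (n - k - 1) 2 + replicate_mset k 1))"
proof -
  have cactus: "cactus V E" and n: "card V = n" and k: "card (pendant_vertices V E) = k"
    using assms(3) by (auto simp: cacti_def)
  have simple: "simple_graph V E" and conn: "connected_graph V E"
    using cactus by (auto simp: cactus_def)
  have fin: "finite V" "V \<noteq> {}" using simple conn by (auto simp: simple_graph_def connected_graph_def)
  then have "n \<noteq> 0" using n by auto
  have degree_pos: "degree E v \<ge> 1" if "v \<in> V" "n \<noteq> 1" for v
  proof -
    have "V \<noteq> {v}" using n that by auto
    then show ?thesis by (rule connected_graph_degree_pos[OF simple conn that(1)])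
  qed
  have "n \<noteq> 2"
  proof
    assume "n = 2"
    then have E: "E \<subseteq> {V}" using simple_graph_card_2[OF simple] n by simp
    have "degree E v = 1" if "v \<in> V" for v
    proof -
      have "degree E v \<le> card {V}" unfolding degree_def using E by (intro card_mono) auto
      then show ?thesis using degree_pos[OF that] \<open>n = 2\<close> by simp
    qed
    then have "pendant_vertices V E = V" by (auto simp: pendant_vertices_def)
    then show False using k n \<open>n = 2\<close> assms(2) by simp
  qed
  show ?thesis
  proof (cases "n = 1")
    \<comment> \<open>The single vertex has degree 0; both sides are 1, again by
      \<open>0 ^ 0 = 1\<close>.\<close>
    case True
    then have E: "E = {}" using simple_graph_card_1[OF simple] n by simp
    then have "k = 0" using k by (simp add: pendant_vertices_def degree_def)
    obtain v where "V = {v}" using True n card_1_singletonE by metis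
    then show ?thesis using True E \<open>k = 0\<close>
      by (simp add: second_mult_zagreb_def degree_sequence_def degree_def)
  next
    case False
    then have three: "n \<ge> 3" using \<open>n \<noteq> 0\<close> \<open>n \<noteq> 2\<close> by linarith
    define S where "S = V - pendant_vertices V E"
    \<comment> \<open>The degree of a vertex that carries the excess of all of
      \<open>S\<close>.\<close>
    define N where "N = 2 + (\<Sum>v\<in>S. degree E v - 2)"
    have pend: "pendant_vertices V E \<subseteq> V" by (auto simp: pendant_vertices_def)
    have finS: "finite S" "finite (pendant_vertices V E)"
      using fin pend by (auto simp: S_def intro: finite_subset)
    have V_split: "V = S \<union> pendant_vertices V E" "S \<inter> pendant_vertices V E = {}"
      using pend by (auto simp: S_def)
    have cardS: "card S = n - k"
      using n k pend finS by (simp add: S_def card_Diff_subset)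
    have "S \<noteq> {}"
      using connected_graph_nonpendant[OF simple conn] three n pend by (auto simp: S_def)
    then have "n - k \<ge> 1" using cardS finS by (metis One_nat_def Suc_leI card_gt_0_iff)
    have deg2: "degree E v \<ge> 2" if "v \<in> S" for v
    proof -
      have "degree E v \<noteq> 1" "v \<in> V" using that by (auto simp: S_def pendant_vertices_def)
      then show ?thesis using degree_pos[of v] False by linarith
    qed
    have pend1: "degree E v = 1" if "v \<in> pendant_vertices V E" for v
      using that by (simp add: pendant_vertices_def)
    have "2 * card E = (\<Sum>v\<in>S. degree E v) + (\<Sum>v\<in>pendant_vertices V E. degree E v)"
      unfolding handshake[OF simple, symmetric]
      by (subst V_split(1), rule sum.union_disjoint) (use finS V_split in auto)
    also have "(\<Sum>v\<in>pendant_vertices V E. degree E v) = k" using pend1 k by simp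
    \<comment> \<open>The subtraction does not truncate, since degrees on \<open>S\<close> are at
      least 2.\<close>
    also have "(\<Sum>v\<in>S. degree E v) = (\<Sum>v\<in>S. (degree E v - 2) + 2)"
      by (rule sum.cong[OF refl]) (metis deg2 le_add_diff_inverse2)
    also have "\<dots> = (\<Sum>v\<in>S. degree E v - 2) + 2 * (n - k)"
      by (simp only: sum.distrib) (simp add: cardS)
    finally have edges: "2 * card E + 2 = N + 2 * (n - k) + k" by (simp add: N_def)
    have "2 * card E + card (pendant_vertices V E) + 3 \<le> 3 * card V"
      using simple conn cactus_nonseparable_degree_le[OF cactus] n \<open>n \<noteq> 2\<close>
      by (intro edges_pendant_bound) auto
    \<comment> \<open>By \<open>edges\<close>, \<open>N = 2 * card E + 2 - 2 * n + k\<close>; the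
      edge bound makes \<open>k\<close> cancel.\<close>
    then have "N \<le> n - 1" using edges n k assms(1) by linarith
    have parity: "even N \<longleftrightarrow> even k"
      using arg_cong[OF edges, of even] by simp
    have "N \<ge> 2" by (simp add: N_def)
    define M where "M = (if even (n - k) then n - 2 else n - 1)"
    have "N \<le> M"
    proof (cases "even (n - k)")
      case True
      \<comment> \<open>\<open>N\<close>, \<open>k\<close> and \<open>n\<close> have the same parity
        here, which rules out \<open>N = n - 1\<close>.\<close>
      then have "even n \<longleftrightarrow> even N" using parity assms(1) by simp
      then have "N \<noteq> n - 1" using three by auto
      then show ?thesis using True \<open>N \<le> n - 1\<close> by (simp add: M_def)
    qed (use \<open>N \<le> n - 1\<close> in \<open>simp add: M_def\<close>)
    have "second_mult_zagreb E = (\<Prod>v\<in>S. degree E v ^ degree E v) *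
        (\<Prod>v\<in>pendant_vertices V E. degree E v ^ degree E v)"
      unfolding second_mult_zagreb_vertices[OF simple]
      by (subst V_split(1), rule prod.union_disjoint) (use finS V_split in auto)
    also have "(\<Prod>v\<in>pendant_vertices V E. degree E v ^ degree E v) = 1" using pend1 by simp
    finally have zagreb: "second_mult_zagreb E = (\<Prod>v\<in>S. degree E v ^ degree E v)" by simp
    have "mset_set V = mset_set S + mset_set (pendant_vertices V E)"
      using finS V_split by (metis mset_set_Union)
    moreover have "image_mset (degree E) (mset_set (pendant_vertices V E)) = replicate_mset k 1"
    proof -
      have "image_mset (degree E) (mset_set (pendant_vertices V E)) =
          image_mset (\<lambda>_. 1) (mset_set (pendant_vertices V E))"
        using pend1 finS by (intro image_mset_cong) auto
      then show ?thesis using k by (simp add: image_mset_const_eq)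
    qed
    ultimately have seq: "degree_sequence V E =
        image_mset (degree E) (mset_set S) + replicate_mset k 1"
      by (simp add: degree_sequence_def)
    have S_bound: "second_mult_zagreb E \<le> N ^ N * 4 ^ (n - k - 1)"
      "second_mult_zagreb E = N ^ N * 4 ^ (n - k - 1) \<Longrightarrow>
        image_mset (degree E) (mset_set S) = {#N#} + replicate_mset (n - k - 1) 2"
      using prod_self_power_le[OF finS(1) \<open>S \<noteq> {}\<close> deg2 N_def] by (auto simp: zagreb cardS)
    have "N ^ N \<le> M ^ M"
      using \<open>N \<le> M\<close> \<open>N \<ge> 2\<close> self_power_strict_mono[of N M] by (cases "N = M") auto
    then have le: "second_mult_zagreb E \<le> M ^ M * 4 ^ (n - k - 1)"
      using S_bound(1) by (meson le_trans mult_le_mono1)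
    have eq: "second_mult_zagreb E = M ^ M * 4 ^ (n - k - 1) \<longleftrightarrow>
        degree_sequence V E = {#M#} + replicate_mset (n - k - 1) 2 + replicate_mset k 1"
    proof
      assume eq: "second_mult_zagreb E = M ^ M * 4 ^ (n - k - 1)"
      \<comment> \<open>A smaller \<open>N\<close> would make the bound through \<open>N\<close>
        strictly smaller than the one through \<open>M\<close>.\<close>
      have "N = M"
      proof (rule ccontr)
        assume "N \<noteq> M"
        then have "N ^ N < M ^ M" using \<open>N \<le> M\<close> \<open>N \<ge> 2\<close> by (intro self_power_strict_mono) auto
        then have "N ^ N * 4 ^ (n - k - 1) < M ^ M * 4 ^ (n - k - 1)" by simp
        then show False using S_bound(1) eq by simp
      qed
      then show "degree_sequence V E = {#M#} + replicate_mset (n - k - 1) 2 + replicate_mset k 1"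
        using S_bound(2) eq seq by simp
    next
      assume "degree_sequence V E = {#M#} + replicate_mset (n - k - 1) 2 + replicate_mset k 1"
      then have "image_mset (degree E) (mset_set S) = {#M#} + replicate_mset (n - k - 1) 2"
        using seq by simp
      \<comment> \<open>The product depends only on the multiset of degrees, so it can be evaluated
        from the entry \<open>M\<close> and the \<open>n - k - 1\<close> twos.\<close>
      moreover have "(\<Prod>v\<in>S. degree E v ^ degree E v) =
          prod_mset (image_mset (\<lambda>d. d ^ d) (image_mset (degree E) (mset_set S)))"
        by (simp add: prod_unfold_prod_mset image_mset.compositionality comp_def)
      ultimately show "second_mult_zagreb E = M ^ M * 4 ^ (n - k - 1)"
        by (simp add: zagreb)
    qed
    have pow: "(2::nat) ^ (2 * (n - k - 1)) = 4 ^ (n - k - 1)" by (simp add: power_mult)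
    show ?thesis
      unfolding pow using le eq by (auto simp: M_def)
  qed
qed

end
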